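(* Let $1\le p<\infty$ and let $X$, $Y$ be Banach spaces. (i) Suppose that $Y$ has the Gelfand-Phillips (GP) property. If $M$ is a closed subspace of $K_{w^*}(X^*,Y)$ such that the evaluation operator $\psi_{y^*}:M\to X$, $\psi_{y^*}(T)=T^*(y^* )$, is limited $p$-convergent for each $y^*\in Y^*$, then $M$ has the $p$-Gelfand-Phillips ($p$-GP) property. (ii) Suppose that $Y$ has the GP property. If $M$ is a closed subspace of $K(X,Y)$ such that the evaluation operator $\psi_{y^*}:M\to X^*$, $\psi_{y^*}(T)=T^*(y^* )$, is limited $p$-convergent for each $y^*\in Y^*$, then $M$ has the $p$-GP property.
   Context: Operators are continuous linear maps, with the operator norm. $K(X,Y)$ is the space of compact operators from $X$ to $Y$; $K_{w^*}(X^*,Y)$ is the space of compact operators from $X^*$ to $Y$ that are $w^*$-$w$ continuous. For $T\in K_{w^*}(X^*,Y)$, the adjoint $T^*$ maps $Y^*$ into $X$ (identified with its canonical image in $X^{**}$). A bounded subset $A$ of a Banach space $E$ is limited if every $w^*$-null sequence $(e_n^* )$ in $E^*$ satisfies $\sup_{x\in A}|e_n^*(x)|\to 0$. A sequence is limited if its set of terms is limited. A sequence $(x_n)$ in $E$ is weakly $p$-summable if $(x^*(x_n))_n\in\ell_p$ for every $x^*\in E^*$. $E$ has the Gelfand-Phillips (GP) property if every limited subset of $E$ is relatively compact. $E$ has the $p$-Gelfand-Phillips ($p$-GP) property if every limited weakly $p$-summable sequence in $E$ (i.e. both limited and weakly $p$-summable) is norm null. An operator $T:E\to F$ is limited $p$-convergent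 if it maps limited weakly $p$-summable sequences in $E$ to norm null sequences in $F$. *)

theory Defs
  imports "HOL-Analysis.Analysis"
begin

text \<open>
  Banach spaces are real; the dual of \<open>'a\<close> is \<open>'a \<Rightarrow>\<^sub>L real\<close>. Notions that are applied to a closed
  subspace of an operator space take the subspace as a set \<open>E\<close>, and refer to functionals
  that are defined on \<open>E\<close> only: their values outside \<open>E\<close> are irrelevant, and no extension to the
  surrounding space is presupposed. For a whole space take \<open>E = UNIV\<close>.
\<close>

definition bounded_linear_on ::
    "'a::real_normed_vector set \<Rightarrow> ('a \<Rightarrow> 'b::real_normed_vector) \<Rightarrow> bool" where
  "bounded_linear_on E f \<longleftrightarrow>
     (\<forall>x\<in>E. \<forall>y\<in>E. f (x + y) = f x + f y) \<and>
     (\<forall>c. \<forall>x\<in>E. f (c *\<^sub>R x) = c *\<^sub>R f x) \<and>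
     (\<exists>K. \<forall>x\<in>E. norm (f x) \<le> K * norm x)"

definition weak_star_null_on ::
    "'a::real_normed_vector set \<Rightarrow> (nat \<Rightarrow> 'a \<Rightarrow> real) \<Rightarrow> bool" where
  "weak_star_null_on E f \<longleftrightarrow>
     (\<forall>n. bounded_linear_on E (f n)) \<and> (\<forall>x\<in>E. (\<lambda>n. f n x) \<longlonglongrightarrow> 0)"

text \<open>The supremum is taken in \<^typ>\<open>ennreal\<close> so that it is \<open>0\<close> when \<open>A\<close> is empty.\<close>

definition limited_on :: "'a::real_normed_vector set \<Rightarrow> 'a set \<Rightarrow> bool" where
  "limited_on E A \<longleftrightarrow> A \<subseteq> E \<and> bounded A \<and>
     (\<forall>f. weak_star_null_on E f \<longrightarrow> (\<lambda>n. SUP x\<in>A. ennreal \<bar>f n x\<bar>) \<longlonglongrightarrow> 0)"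

definition weakly_summable_on ::
    "real \<Rightarrow> 'a::real_normed_vector set \<Rightarrow> (nat \<Rightarrow> 'a) \<Rightarrow> bool" where
  "weakly_summable_on p E x \<longleftrightarrow> range x \<subseteq> E \<and>
     (\<forall>f::'a \<Rightarrow> real. bounded_linear_on E f \<longrightarrow> summable (\<lambda>n. \<bar>f (x n)\<bar> powr p))"

text \<open>As \<open>E\<close> is meant to be closed, relative compactness in \<open>E\<close> can be expressed with \<^const>\<open>closure\<close>.\<close>

definition gelfand_phillips :: "'a::real_normed_vector set \<Rightarrow> bool" where
  "gelfand_phillips E \<longleftrightarrow> (\<forall>A. limited_on E A \<longrightarrow> compact (closure A))"

definition p_gelfand_phillips :: "real \<Rightarrow> 'a::real_normed_vector set \<Rightarrow> bool" where
  "p_gelfand_phillips p E \<longleftrightarrow>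
     (\<forall>x. limited_on E (range x) \<and> weakly_summable_on p E x \<longrightarrow> x \<longlonglongrightarrow> 0)"

definition limited_p_convergent_on ::
    "real \<Rightarrow> 'a::real_normed_vector set \<Rightarrow> ('a \<Rightarrow> 'b::real_normed_vector) \<Rightarrow> bool" where
  "limited_p_convergent_on p E T \<longleftrightarrow> bounded_linear_on E T \<and>
     (\<forall>x. limited_on E (range x) \<and> weakly_summable_on p E x \<longrightarrow> (\<lambda>n. T (x n)) \<longlonglongrightarrow> 0)"

text \<open>On function spaces \<^const>\<open>euclidean\<close> is the topology of pointwise convergence.\<close>

definition weak_topology :: "'a::real_normed_vector topology" where
  "weak_topology = pullback_topology UNIV (\<lambda>x (f::'a \<Rightarrow>\<^sub>L real). blinfun_apply f x) euclidean"

definition weak_star_topology :: "('a::real_normed_vector \<Rightarrow>\<^sub>L real) topology" where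
  "weak_star_topology = strong_operator_topology"

definition compact_operators ::
    "('a::real_normed_vector \<Rightarrow>\<^sub>L 'b::real_normed_vector) set" where
  "compact_operators = {T. compact (closure (blinfun_apply T ` cball 0 1))}"

definition weak_star_weak_compact_operators ::
    "(('a::real_normed_vector \<Rightarrow>\<^sub>L real) \<Rightarrow>\<^sub>L 'b::real_normed_vector) set" where
  "weak_star_weak_compact_operators =
     {T \<in> compact_operators. continuous_map weak_star_topology weak_topology (blinfun_apply T)}"

definition dual_adjoint ::
    "('a::real_normed_vector \<Rightarrow>\<^sub>L 'b::real_normed_vector) \<Rightarrow> ('b \<Rightarrow>\<^sub>L real) \<Rightarrow> ('a \<Rightarrow>\<^sub>L real)" where
  "dual_adjoint T g = g o\<^sub>L T"

lift_definition canonical_embedding ::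
    "'a::real_normed_vector \<Rightarrow> (('a \<Rightarrow>\<^sub>L real) \<Rightarrow>\<^sub>L real)" is
  "\<lambda>x f. blinfun_apply f x"
  by (rule blinfun.bounded_linear_left)

text \<open>
  For a weak*-to-weak continuous operator on a dual space the adjoint takes its values in the
  image of the canonical embedding, which is injective. The following is that adjoint, read as a
  map into the predual; it is meaningful for such operators only.
\<close>

definition predual_adjoint ::
    "(('a::real_normed_vector \<Rightarrow>\<^sub>L real) \<Rightarrow>\<^sub>L 'b::real_normed_vector) \<Rightarrow> ('b \<Rightarrow>\<^sub>L real) \<Rightarrow> 'a" where
  "predual_adjoint T g = (THE x. canonical_embedding x = dual_adjoint T g)"

end

theory Submission
  imports Defs
begin

text \<open>
  Let \<open>(T\<^sub>n)\<close> be limited and weakly \<open>p\<close>-summable in \<open>M\<close>. If \<open>(g\<^sub>k)\<close> is weak* null in the dual of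
  \<open>Y\<close> and \<open>(x\<^sub>k)\<close> lies in the unit ball, then \<open>T \<mapsto> g\<^sub>k (T x\<^sub>k)\<close> is weak* null on \<open>M\<close>, because \<open>(g\<^sub>k)\<close>
  tends to \<open>0\<close> uniformly on compact sets and each \<open>T\<close> is compact. Hence the union of the images of
  the unit ball under all \<open>T\<^sub>n\<close> is limited in \<open>Y\<close>, so relatively compact. If \<open>(T\<^sub>n)\<close> were not norm null,
  some sequence \<open>(T\<^sub>n x\<^sub>n)\<close> would have a nonzero limit point; but every functional \<open>g\<close> vanishes there,
  since \<open>\<bar>g (T\<^sub>n x\<^sub>n)\<bar>\<close> is at most the norm of the adjoint of \<open>T\<^sub>n\<close> at \<open>g\<close>, which tends to \<open>0\<close>.
\<close>

section \<open>Norming functionals\<close>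

text \<open>
  Zorn's lemma is applied to graphs \<open>G\<close> of functionals dominated by the norm. They need not be
  required to be graphs of functions: \<open>(0, c) \<in> G\<close> forces both \<open>c \<le> 0\<close> and \<open>- c \<le> 0\<close>.
\<close>

lemma dominated_subspace_extend:
  fixes G :: "('a::real_normed_vector \<times> real) set" and v :: 'a
  assumes G: "subspace G" and dom: "\<And>u c. (u, c) \<in> G \<Longrightarrow> c \<le> norm u"
  obtains a where "\<And>u c. (u, c) \<in> span (insert (v, a) G) \<Longrightarrow> c \<le> norm u"
proof -
  \<comment> \<open>Domination for coefficients 1 and -1 of \<open>v\<close> asks for
    \<open>d + a \<le> norm (w + v)\<close> and \<open>c - a \<le> norm (u - v)\<close>.
    \<open>L\<close> collects the resulting lower bounds for \<open>a\<close>; by \<open>le\<close>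
    each lies below every upper bound.\<close>
  define L where "L = (\<lambda>(u, c). c - norm (u - v)) ` G"
  have le: "c - norm (u - v) \<le> norm (w + v) - d" if "(u, c) \<in> G" "(w, d) \<in> G" for u c w d
  proof -
    have "(u + w, c + d) \<in> G"
      using subspace_add[OF G that] by simp
    then have "c + d \<le> norm (u + w)"
      by (rule dom)
    also have "\<dots> \<le> norm (u - v) + norm (w + v)"
      using norm_triangle_ineq[of "u - v" "w + v"] by (simp add: algebra_simps)
    finally show ?thesis by simp
  qed
  have zero: "(0, 0) \<in> G"
    using subspace_0[OF G] by (simp add: zero_prod_def)
  have bdd: "bdd_above L"
    unfolding L_def using le[OF _ zero] by (intro bdd_aboveI2[where M = "norm v"]) auto
  define a where "a = Sup L"
  have lower: "c - norm (u - v) \<le> a" if "(u, c) \<in> G" for u c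
    unfolding a_def L_def using that bdd[unfolded L_def] by (intro cSup_upper) force+
  have upper: "a \<le> norm (w + v) - d" if "(w, d) \<in> G" for w d
    unfolding a_def L_def using zero le[OF _ that] by (intro cSup_least) auto
  have "c \<le> norm u" if uc: "(u, c) \<in> span (insert (v, a) G)" for u c
  proof -
    obtain t where "(u, c) - t *\<^sub>R (v, a) \<in> span G"
      using uc by (auto simp: span_insert)
    then have mem: "(u - t *\<^sub>R v, c - t * a) \<in> G"
      using G by (simp add: span_eq_iff[THEN iffD2])
    \<comment> \<open>Scaling by \<open>1 / \<bar>t\<bar>\<close> reduces a nonzero \<open>t\<close>
      to coefficient 1 or -1, which \<open>upper\<close> and \<open>lower\<close> settle.\<close>
    consider "t = 0" | "t > 0" | "t < 0" by linarith
    then show ?thesis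
    proof cases
      case 1
      then show ?thesis using dom mem by simp
    next
      case 2
      have "a \<le> norm ((1/t) *\<^sub>R (u - t *\<^sub>R v) + v) - (1/t) * (c - t * a)"
        using subspace_scale[OF G mem, of "1/t"] by (intro upper) simp
      also have "(1/t) *\<^sub>R (u - t *\<^sub>R v) + v = (1/t) *\<^sub>R u"
        using 2 by (simp add: algebra_simps)
      finally show ?thesis
        using 2 by (simp add: field_simps)
    next
      case 3
      define s where "s = - t"
      have s: "s > 0" "t = - s" using 3 by (auto simp: s_def)
      have "(1/s) * (c - t * a) - norm ((1/s) *\<^sub>R (u - t *\<^sub>R v) - v) \<le> a"
        using subspace_scale[OF G mem, of "1/s"] by (intro lower) simp
      also have "(1/s) *\<^sub>R (u - t *\<^sub>R v) - v = (1/s) *\<^sub>R u"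
        using s by (simp add: algebra_simps)
      finally show ?thesis
        using s by (simp add: field_simps)
    qed
  qed
  then show thesis by (rule that)
qed

lemma subspace_Union_chain:
  fixes C :: "'a::real_vector set set"
  assumes "C \<noteq> {}" and sub: "\<And>S. S \<in> C \<Longrightarrow> subspace S"
    and chain: "\<And>S T. S \<in> C \<Longrightarrow> T \<in> C \<Longrightarrow> S \<subseteq> T \<or> T \<subseteq> S"
  shows "subspace (\<Union>C)"
proof (rule subspaceI)
  show "0 \<in> \<Union>C"
    using assms(1) sub subspace_0 by blast
next
  fix x y assume "x \<in> \<Union>C" "y \<in> \<Union>C"
  then obtain S T where "S \<in> C" "x \<in> S" "T \<in> C" "y \<in> T" by blast
  then obtain U where "U \<in> C" "x \<in> U" "y \<in> U"
    using chain[of S T] by blast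
  then show "x + y \<in> \<Union>C"
    using sub subspace_add by blast
next
  fix c x assume "x \<in> \<Union>C"
  then show "c *\<^sub>R x \<in> \<Union>C"
    using sub subspace_scale by blast
qed

text \<open>A maximal dominated graph through \<open>(y, norm y)\<close> reaches every vector, since
  it could otherwise be extended. Domination at both \<open>v\<close> and \<open>- v\<close> then
  bounds the functional by the norm.\<close>

lemma ex_norming_functional:
  fixes y :: "'a::real_normed_vector"
  obtains g :: "'a \<Rightarrow>\<^sub>L real" where "g y = norm y" "norm g \<le> 1"
proof -
  define A where "A = {G :: ('a \<times> real) set. subspace G \<and> (y, norm y) \<in> G
    \<and> (\<forall>u c. (u, c) \<in> G \<longrightarrow> c \<le> norm u)}"
  have "span {(y, norm y)} \<in> A"
  proof -
    have "t * norm y \<le> norm (t *\<^sub>R y)" for t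
      by (simp add: mult_right_mono)
    then show ?thesis
      using span_base[of "(y, norm y)"] subspace_span[of "{(y, norm y)}"]
      unfolding A_def by (fastforce simp: span_singleton)
  qed
  then have ne: "A \<noteq> {}" by blast
  have "\<exists>G\<in>A. \<forall>X\<in>A. G \<subseteq> X \<longrightarrow> X = G"
  proof (rule subset_Zorn_nonempty[OF ne])
    fix C assume C: "C \<noteq> {}" "subset.chain A C"
    then have "subspace (\<Union>C)"
      by (intro subspace_Union_chain) (auto simp: A_def subset_chain_def)
    then show "\<Union>C \<in> A"
      using C by (fastforce simp: A_def subset_chain_def)
  qed
  then obtain G where GA: "G \<in> A" and max: "\<And>X. X \<in> A \<Longrightarrow> G \<subseteq> X \<Longrightarrow> X = G"
    by blast
  have G: "subspace G" and yG: "(y, norm y) \<in> G" and dom: "\<And>u c. (u, c) \<in> G \<Longrightarrow> c \<le> norm u"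
    using GA by (auto simp: A_def)
  have total: "\<exists>a. (v, a) \<in> G" for v
  proof -
    obtain a where a: "\<And>u c. (u, c) \<in> span (insert (v, a) G) \<Longrightarrow> c \<le> norm u"
      using dominated_subspace_extend[OF G dom] by blast
    have "span (insert (v, a) G) \<in> A"
      using a yG by (auto simp: A_def intro: span_base)
    then have "span (insert (v, a) G) = G"
      by (rule max) (auto intro: span_base)
    then show ?thesis
      using span_base[of "(v, a)" "insert (v, a) G"] by auto
  qed
  have unique: "a = b" if "(v, a) \<in> G" "(v, b) \<in> G" for v a b
    using dom[of 0 "a - b"] dom[of 0 "b - a"] subspace_diff[OF G that]
      subspace_diff[OF G that(2,1)] by simp
  obtain h where h: "\<And>v. (v, h v) \<in> G"
    using total by metis
  have eq: "h v = a" if "(v, a) \<in> G" for v a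
    using unique[OF h that] .
  have add: "h (u + v) = h u + h v" for u v
    using subspace_add[OF G h h, of u v] by (intro eq) simp
  have scale: "h (c *\<^sub>R v) = c *\<^sub>R h v" for c v
    using subspace_scale[OF G h, of c v] by (intro eq) simp
  have bound: "norm (h v) \<le> 1 * norm v" for v
    using dom[OF h, of v] dom[OF h, of "- v"] scale[of "-1" v] by (simp add: abs_le_iff)
  have lin: "bounded_linear h"
    using add scale bound by (intro bounded_linear_intro[where K = 1]) auto
  show thesis
  proof (rule that[of "Blinfun h"])
    show "Blinfun h y = norm y"
      using eq[OF yG] lin by (simp add: bounded_linear_Blinfun_apply)
    show "norm (Blinfun h) \<le> 1"
      using bound lin by (intro norm_blinfun_bound) (auto simp: bounded_linear_Blinfun_apply)
  qed
qed

lemma eq_zero_if_functionals_vanish: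
  fixes y :: "'a::real_normed_vector"
  assumes "\<And>g :: 'a \<Rightarrow>\<^sub>L real. g y = 0"
  shows "y = 0"
  using ex_norming_functional[of y] assms by (metis norm_eq_zero)

section \<open>Weak* null sequences\<close>

text \<open>By Baire, one of the closed sets \<open>F k\<close> covering the complete space contains
  a ball, and differences of points of that ball reach all directions.\<close>

lemma banach_steinhaus:
  fixes f :: "nat \<Rightarrow> 'a::banach \<Rightarrow>\<^sub>L 'b::real_normed_vector"
  assumes "\<And>x. bounded (range (\<lambda>n. f n x))"
  obtains C where "\<And>n. norm (f n) \<le> C"
proof -
  define F where "F k = {x. \<forall>n. norm (f n x) \<le> real k}" for k
  have closed: "closed (F k)" for k
    unfolding F_def
    by (intro closed_Collect_all closed_Collect_le continuous_intros)
  have "\<Union>(range F) = UNIV"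
  proof -
    have "\<exists>k. x \<in> F k" for x
    proof -
      obtain B where "\<And>n. norm (f n x) \<le> B"
        using assms[of x] by (auto simp: bounded_iff)
      then show ?thesis
        using real_arch_simple[of B] unfolding F_def by (auto intro: order_trans)
    qed
    then show ?thesis by auto
  qed
  moreover have "euclidean interior_of \<Union>(range F) = {}" if "\<And>k. interior (F k) = {}"
    using that closed
    by (intro Baire_category_alt) (auto simp: completely_metrizable_space_euclidean)
  ultimately obtain k where "interior (F k) \<noteq> {}"
    by fastforce
  then obtain a r where r: "r > 0" "ball a r \<subseteq> F k"
    by (meson all_not_in_conv mem_interior)
  have "norm (f n) \<le> 2 * real k / (r / 2)" for n
  proof (rule norm_blinfun_bound)
    show "0 \<le> 2 * real k / (r / 2)" using r by simp
    fix x
    show "norm (f n x) \<le> 2 * real k / (r / 2) * norm x"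
    proof (cases "x = 0")
      case False
      \<comment> \<open>\<open>t *\<^sub>R x\<close> has norm \<open>r / 2\<close>, so
        \<open>a + t *\<^sub>R x\<close> stays in the ball; subtracting the value at
        \<open>a\<close> costs the factor 2.\<close>
      define t where "t = r / 2 / norm x"
      have t: "t > 0" using r False by (simp add: t_def)
      have "a \<in> F k" "a + t *\<^sub>R x \<in> F k"
        using r False by (auto simp: t_def dist_norm intro!: subsetD[OF r(2)])
      then have "norm (f n a) \<le> k" "norm (f n (a + t *\<^sub>R x)) \<le> k"
        by (auto simp: F_def)
      then have "norm (f n (t *\<^sub>R x)) \<le> 2 * real k"
        using norm_triangle_ineq4[of "f n (a + t *\<^sub>R x)" "f n a"] by (simp add: blinfun.add_right)
      then have "t * norm (f n x) \<le> 2 * real k"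
        using t by (simp add: blinfun.scaleR_right)
      then have "norm (f n x) \<le> 2 * real k / t"
        using t by (simp add: field_simps)
      also have "\<dots> = 2 * real k / (r / 2) * norm x"
        using r False by (simp add: t_def field_simps)
      finally show ?thesis .
    qed simp
  qed
  then show thesis by (rule that)
qed

text \<open>The uniform norm bound makes the functionals equicontinuous, so smallness on a finite
  net of \<open>K\<close> spreads to all of \<open>K\<close>.\<close>

lemma weak_star_null_tendsto_on_compact:
  fixes f :: "nat \<Rightarrow> 'a::banach \<Rightarrow>\<^sub>L real"
  assumes null: "\<And>x. (\<lambda>n. f n x) \<longlonglongrightarrow> 0" and "compact K" and xK: "\<And>n. x n \<in> K"
  shows "(\<lambda>n. f n (x n)) \<longlonglongrightarrow> 0"
proof (rule tendstoI)
  fix e :: real assume e: "e > 0"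
  obtain C where C: "\<And>n. norm (f n) \<le> C"
    using banach_steinhaus[of f] convergent_imp_bounded[OF null] by blast
  have C0: "C \<ge> 0" using C[of 0] norm_ge_zero order_trans by blast
  \<comment> \<open>\<open>C + 1\<close> in place of \<open>C\<close> keeps the denominator positive
    when \<open>C = 0\<close>.\<close>
  define d where "d = e / (2 * (C + 1))"
  have d: "d > 0" "C * d < e / 2"
    using e C0 by (auto simp: d_def field_simps)
  obtain D where D: "finite D" "K \<subseteq> (\<Union>c\<in>D. ball c d)"
    using \<open>compact K\<close> d(1) unfolding compact_eq_totally_bounded by meson
  have "eventually (\<lambda>n. \<forall>c\<in>D. norm (f n c) < e / 2) sequentially"
    using D(1) tendstoD[OF null, of "e / 2"] e by (simp add: eventually_ball_finite_distrib)
  then show "eventually (\<lambda>n. dist (f n (x n)) 0 < e) sequentially"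
  proof eventually_elim
    case (elim n)
    obtain c where c: "c \<in> D" "dist c (x n) < d"
      using D(2) xK[of n] by auto
    have "norm (f n (x n - c)) \<le> norm (f n) * norm (x n - c)"
      by (rule norm_blinfun)
    also have "\<dots> \<le> C * d"
      using C c(2) C0 by (intro mult_mono) (auto simp: dist_norm norm_minus_commute)
    finally have "norm (f n (x n) - f n c) < e / 2"
      using d(2) by (simp add: blinfun.diff_right)
    moreover have "norm (f n c) < e / 2"
      using elim c(1) by blast
    ultimately show ?case
      unfolding dist_norm real_norm_def by linarith
  qed
qed

text \<open>This trades the supremum in the definition of limited sets for a uniform estimate on
  real values.\<close>

lemma SUP_ennreal_tendsto_zero_iff:
  fixes f :: "nat \<Rightarrow> 'a \<Rightarrow> real"
  shows "(\<lambda>n. SUP x\<in>A. ennreal \<bar>f n x\<bar>) \<longlonglongrightarrow> 0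
    \<longleftrightarrow> (\<forall>e>0. \<forall>\<^sub>F n in sequentially. \<forall>x\<in>A. \<bar>f n x\<bar> \<le> e)"
proof safe
  fix e :: real
  assume "(\<lambda>n. SUP x\<in>A. ennreal \<bar>f n x\<bar>) \<longlonglongrightarrow> 0" and e: "e > 0"
  then have "\<forall>\<^sub>F n in sequentially. (SUP x\<in>A. ennreal \<bar>f n x\<bar>) < ennreal e"
    by (intro order_tendstoD(2)) auto
  then show "\<forall>\<^sub>F n in sequentially. \<forall>x\<in>A. \<bar>f n x\<bar> \<le> e"
  proof eventually_elim
    case (elim n)
    show ?case
    proof
      fix x assume "x \<in> A"
      then have "ennreal \<bar>f n x\<bar> \<le> ennreal e"
        using elim by (meson SUP_upper less_imp_le order_trans)
      then show "\<bar>f n x\<bar> \<le> e"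
        using e by (simp add: ennreal_le_iff)
    qed
  qed
next
  assume *: "\<forall>e>0. \<forall>\<^sub>F n in sequentially. \<forall>x\<in>A. \<bar>f n x\<bar> \<le> e"
  show "(\<lambda>n. SUP x\<in>A. ennreal \<bar>f n x\<bar>) \<longlonglongrightarrow> 0"
  proof (rule order_tendstoI)
    fix b :: ennreal assume "0 < b"
    \<comment> \<open>Being strictly below \<open>b\<close>, \<open>c\<close> is finite and so comes
      from a real \<open>e\<close>, even if \<open>b\<close> is infinite.\<close>
    then obtain c where c: "0 < c" "c < b"
      using dense by blast
    then obtain e where e: "e > 0" "ennreal e < b"
      by (cases c) auto
    have "\<forall>\<^sub>F n in sequentially. \<forall>x\<in>A. \<bar>f n x\<bar> \<le> e"
      using * e by blast
    then show "\<forall>\<^sub>F n in sequentially. (SUP x\<in>A. ennreal \<bar>f n x\<bar>) < b"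
    proof eventually_elim
      case (elim n)
      then have "(SUP x\<in>A. ennreal \<bar>f n x\<bar>) \<le> ennreal e"
        by (intro SUP_least) (auto intro: ennreal_leI)
      then show ?case using e(2) by (rule le_less_trans)
    qed
  qed simp
qed

lemma bounded_linear_on_UNIV: "bounded_linear_on UNIV f \<longleftrightarrow> bounded_linear f"
proof
  assume "bounded_linear_on UNIV f"
  then obtain K where "\<And>x y. f (x + y) = f x + f y" "\<And>c x. f (c *\<^sub>R x) = c *\<^sub>R f x"
    "\<And>x. norm (f x) \<le> K * norm x"
    by (auto simp: bounded_linear_on_def)
  then show "bounded_linear f"
    by (intro bounded_linear_intro[where K = K]) (auto simp: mult.commute)
next
  assume "bounded_linear f"
  then interpret bounded_linear f .
  show "bounded_linear_on UNIV f"
    using bounded by (auto simp: bounded_linear_on_def add scaleR mult.commute)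
qed

section \<open>Limited sequences of compact operators\<close>

lemma limited_orbit_of_unit_ball:
  fixes T :: "nat \<Rightarrow> 'a::real_normed_vector \<Rightarrow>\<^sub>L 'b::banach"
  assumes M: "M \<subseteq> compact_operators" and lim: "limited_on M (range T)"
  shows "limited_on UNIV (\<Union>n. blinfun_apply (T n) ` cball 0 1)" (is "limited_on UNIV ?S")
  unfolding limited_on_def
proof (intro conjI allI impI)
  obtain B where B: "\<And>n. norm (T n) \<le> B"
    using lim by (auto simp: limited_on_def bounded_iff)
  have "norm (T n x) \<le> B" if "norm x \<le> 1" for n x
  proof -
    have "norm (T n x) \<le> norm (T n) * norm x" by (rule norm_blinfun)
    also have "\<dots> \<le> B * 1" using that B[of n] order_trans[OF norm_ge_zero B]
      by (intro mult_mono) auto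
    finally show ?thesis by simp
  qed
  then show "bounded ?S"
    unfolding bounded_iff by fastforce
next
  fix f assume "weak_star_null_on (UNIV :: 'b set) f"
  then have lin: "\<And>n. bounded_linear (f n)" and null: "\<And>y. (\<lambda>n. f n y) \<longlonglongrightarrow> 0"
    by (auto simp: weak_star_null_on_def bounded_linear_on_UNIV)
  define g where "g n = Blinfun (f n)" for n
  have g: "blinfun_apply (g n) = f n" for n
    using lin by (simp add: g_def bounded_linear_Blinfun_apply)
  show "(\<lambda>n. SUP y\<in>?S. ennreal \<bar>f n y\<bar>) \<longlonglongrightarrow> 0"
    unfolding SUP_ennreal_tendsto_zero_iff
  proof (intro allI impI)
    fix e :: real assume e: "e > 0"
    \<comment> \<open>\<open>x k\<close> is a unit ball vector at which some \<open>T n\<close>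
      violates the bound \<open>e\<close> for \<open>f k\<close>, if there is one, and any unit ball
      vector otherwise. A single functional per \<open>k\<close> thus detects every
      violation.\<close>
    have "\<exists>x. norm x \<le> 1 \<and> ((\<exists>y\<in>?S. \<bar>f k y\<bar> > e) \<longrightarrow> (\<exists>n. \<bar>f k (T n x)\<bar> > e))" for k
      by (cases "\<exists>y\<in>?S. \<bar>f k y\<bar> > e") (auto intro: exI[of _ 0])
    then obtain x where x: "\<And>k. norm (x k) \<le> 1"
      "\<And>k. (\<exists>y\<in>?S. \<bar>f k y\<bar> > e) \<Longrightarrow> \<exists>n. \<bar>f k (T n (x k))\<bar> > e"
      by metis
    have "weak_star_null_on M (\<lambda>k R. f k (blinfun_apply R (x k)))"
      unfolding weak_star_null_on_def
    proof (intro conjI allI ballI)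
      fix k
      have "norm (f k (R (x k))) \<le> norm (g k) * norm (x k) * norm R" for R :: "'a \<Rightarrow>\<^sub>L 'b"
      proof -
        have "norm (f k (R (x k))) \<le> norm (g k) * norm (R (x k))"
          using norm_blinfun[of "g k"] by (simp add: g)
        also have "\<dots> \<le> norm (g k) * (norm R * norm (x k))"
          by (intro mult_left_mono norm_blinfun) auto
        finally show ?thesis by (simp add: mult_ac)
      qed
      then show "bounded_linear_on M (\<lambda>R. f k (blinfun_apply R (x k)))"
        using linear_add[OF bounded_linear.linear[OF lin]]
          linear_scale[OF bounded_linear.linear[OF lin]]
        by (auto simp: bounded_linear_on_def blinfun.add_left blinfun.scaleR_left)
    next
      fix R assume "R \<in> M"
      \<comment> \<open>The points \<open>R (x k)\<close> vary with \<open>k\<close> but stay in one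
        compact set, on which the functionals tend to 0 uniformly.\<close>
      then have "compact (closure (blinfun_apply R ` cball 0 1))"
        using M by (auto simp: compact_operators_def)
      moreover have "R (x k) \<in> closure (blinfun_apply R ` cball 0 1)" for k
        using x(1) by (intro subsetD[OF closure_subset]) auto
      ultimately show "(\<lambda>k. f k (blinfun_apply R (x k))) \<longlonglongrightarrow> 0"
        using weak_star_null_tendsto_on_compact[of g] null by (simp add: g)
    qed
    then have "(\<lambda>k. SUP R\<in>range T. ennreal \<bar>f k (blinfun_apply R (x k))\<bar>) \<longlonglongrightarrow> 0"
      using lim by (auto simp: limited_on_def)
    then have "\<forall>\<^sub>F k in sequentially. \<forall>R\<in>range T. \<bar>f k (blinfun_apply R (x k))\<bar> \<le> e"
      using e unfolding SUP_ennreal_tendsto_zero_iff by blast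
    then show "\<forall>\<^sub>F k in sequentially. \<forall>y\<in>?S. \<bar>f k y\<bar> \<le> e"
    proof eventually_elim
      case (elim k)
      then show ?case using x(2)[of k] by (meson linorder_not_le rangeI)
    qed
  qed
qed simp

text \<open>The operator norm is the least nonnegative bound, so \<open>e\<close> fails as a bound
  at some vector, which is then normalised.\<close>

lemma ex_unit_ball_norm_gt:
  fixes T :: "'a::real_normed_vector \<Rightarrow>\<^sub>L 'b::real_normed_vector"
  assumes "0 \<le> e" "e < norm T"
  obtains x where "norm x \<le> 1" "norm (T x) > e"
proof -
  obtain z where z: "norm (T z) > e * norm z"
    using norm_blinfun_bound[of e T] assms by (meson not_le)
  then have "z \<noteq> 0" by auto
  then have "norm (T ((1 / norm z) *\<^sub>R z)) > e"
    using z by (simp add: blinfun.scaleR_right field_simps)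
  with \<open>z \<noteq> 0\<close> show thesis by (intro that[of "(1 / norm z) *\<^sub>R z"]) auto
qed

lemma norm_null_if_orbit_compact:
  fixes T :: "nat \<Rightarrow> 'a::real_normed_vector \<Rightarrow>\<^sub>L 'b::real_normed_vector"
  assumes comp: "compact (closure (\<Union>n. blinfun_apply (T n) ` cball 0 1))"
    and adj: "\<And>g. (\<lambda>n. dual_adjoint (T n) g) \<longlonglongrightarrow> 0"
  shows "T \<longlonglongrightarrow> 0"
proof (rule tendstoI, rule ccontr)
  fix e :: real assume e: "e > 0" and "\<not> (\<forall>\<^sub>F n in sequentially. dist (T n) 0 < e)"
  then obtain r :: "nat \<Rightarrow> nat" where r: "strict_mono r" "\<And>n. \<not> dist (T (r n)) 0 < e"
    using not_eventually_sequentiallyD by blast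
  \<comment> \<open>The norm need not be attained on the unit ball, so \<open>e\<close> is halved to
    leave room.\<close>
  have "\<exists>x. norm x \<le> 1 \<and> norm (T (r n) x) > e / 2" for n
    using ex_unit_ball_norm_gt[of "e / 2" "T (r n)"] r(2)[of n] e by auto
  then obtain x where x: "\<And>n. norm (x n) \<le> 1" "\<And>n. norm (T (r n) (x n)) > e / 2"
    by metis
  have "T (r n) (x n) \<in> closure (\<Union>n. blinfun_apply (T n) ` cball 0 1)" for n
    using x(1) by (intro subsetD[OF closure_subset] UN_I[of "r n"]) auto
  then obtain l s where s: "strict_mono s" "((\<lambda>n. T (r n) (x n)) \<circ> s) \<longlonglongrightarrow> l"
    using comp unfolding compact_def by meson
  have "g l = 0" for g :: "'b \<Rightarrow>\<^sub>L real"
  proof -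
    have "(\<lambda>n. dual_adjoint (T (r (s n))) g) \<longlonglongrightarrow> 0"
      using LIMSEQ_subseq_LIMSEQ[OF LIMSEQ_subseq_LIMSEQ[OF adj r(1)] s(1)] by (simp add: o_def)
    moreover have "norm (g (T (r (s n)) (x (s n)))) \<le> norm (dual_adjoint (T (r (s n))) g)" for n
    proof -
      have "norm (dual_adjoint (T (r (s n))) g (x (s n)))
          \<le> norm (dual_adjoint (T (r (s n))) g) * norm (x (s n))"
        by (rule norm_blinfun)
      also have "\<dots> \<le> norm (dual_adjoint (T (r (s n))) g)"
        using x(1) by (intro mult_left_le) auto
      finally show ?thesis
        by (simp add: dual_adjoint_def)
    qed
    ultimately have "(\<lambda>n. g (T (r (s n)) (x (s n)))) \<longlonglongrightarrow> 0"
      by - (rule tendsto_0_le[where K = 1], assumption, simp)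
    moreover have "(\<lambda>n. g (T (r (s n)) (x (s n)))) \<longlonglongrightarrow> g l"
      using blinfun.tendsto[OF tendsto_const s(2)] by (simp add: o_def)
    ultimately show ?thesis by (rule LIMSEQ_unique[rotated])
  qed
  then have "l = 0" by (rule eq_zero_if_functionals_vanish)
  moreover have "e / 2 \<le> norm l"
    using x(2) by (intro LIMSEQ_le_const[OF tendsto_norm[OF s(2)]]) (auto simp: less_imp_le)
  ultimately show False using e by simp
qed

text \<open>The common core of both claims: each only has to turn its evaluation hypothesis into
  norm convergence of the adjoints.\<close>

lemma p_gelfand_phillips_if_adjoints_null:
  fixes M :: "('a::real_normed_vector \<Rightarrow>\<^sub>L 'b::banach) set"
  assumes "gelfand_phillips (UNIV :: 'b set)" and "M \<subseteq> compact_operators"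
    and "\<And>T g. limited_on M (range T) \<Longrightarrow> weakly_summable_on p M T \<Longrightarrow>
           (\<lambda>n. dual_adjoint (T n) g) \<longlonglongrightarrow> 0"
  shows "p_gelfand_phillips p M"
  unfolding p_gelfand_phillips_def
proof (intro allI impI, elim conjE)
  fix T assume T: "limited_on M (range T)" "weakly_summable_on p M T"
  have "limited_on UNIV (\<Union>n. blinfun_apply (T n) ` cball 0 1)"
    using assms(2) T(1) by (rule limited_orbit_of_unit_ball)
  then have "compact (closure (\<Union>n. blinfun_apply (T n) ` cball 0 1))"
    using assms(1) unfolding gelfand_phillips_def by (elim allE impE)
  then show "T \<longlonglongrightarrow> 0"
    using assms(3)[OF T] by (rule norm_null_if_orbit_compact)
qed

section \<open>Adjoints of weak*-to-weak continuous operators\<close>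

lemma canonical_embedding_apply: "canonical_embedding x f = f x"
  by transfer simp

lemma norm_canonical_embedding_le: "norm (canonical_embedding x) \<le> norm x"
proof (rule norm_blinfun_bound)
  fix f show "norm (canonical_embedding x f) \<le> norm x * norm f"
    using norm_blinfun[of f x] by (simp add: canonical_embedding_apply mult.commute)
qed simp

text \<open>Norming functionals separate points. This supplies the uniqueness behind
  \<open>predual_adjoint\<close>.\<close>

lemma canonical_embedding_inject: "canonical_embedding x = canonical_embedding y \<longleftrightarrow> x = y"
proof
  assume eq: "canonical_embedding x = canonical_embedding y"
  have "f (x - y) = 0" for f :: "'a \<Rightarrow>\<^sub>L real"
    using arg_cong[OF eq, of "\<lambda>h. blinfun_apply h f"]
    by (simp add: canonical_embedding_apply blinfun.diff_right)
  then show "x = y"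
    using eq_zero_if_functionals_vanish[of "x - y"] by simp
qed simp

text \<open>Such a functional is a linear combination of the evaluations at the points of
  \<open>F\<close>; the induction removes one point at a time.\<close>

lemma canonical_embedding_if_vanishes_on_annihilator:
  fixes \<phi> :: "('a::real_normed_vector \<Rightarrow>\<^sub>L real) \<Rightarrow>\<^sub>L real"
  assumes "finite F" and "\<And>f. (\<forall>x\<in>F. blinfun_apply f x = 0) \<Longrightarrow> \<phi> f = 0"
  shows "\<exists>x. canonical_embedding x = \<phi>"
  using assms
proof (induction F arbitrary: \<phi> rule: finite_induct)
  case empty
  then have "canonical_embedding 0 = \<phi>"
    by (intro blinfun_eqI) (simp add: canonical_embedding_apply)
  then show ?case by blast
next
  case (insert a F)
  show ?case
  proof (cases "\<exists>f :: 'a \<Rightarrow>\<^sub>L real. (\<forall>x\<in>F. blinfun_apply f x = 0) \<and> f a \<noteq> 0")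
    \<comment> \<open>Vanishing on \<open>F\<close> already forces vanishing at
      \<open>a\<close>.\<close>
    case False
    then have "\<phi> f = 0" if "\<forall>x\<in>F. blinfun_apply f x = 0" for f
      using that False by (intro insert.prems) blast
    then show ?thesis by (rule insert.IH)
  next
    case True
    then obtain f1 :: "'a \<Rightarrow>\<^sub>L real" where f1: "\<And>x. x \<in> F \<Longrightarrow> blinfun_apply f1 x = 0" "f1 a \<noteq> 0" by blast
    \<comment> \<open>\<open>f0\<close> vanishes on \<open>F\<close> and is 1 at \<open>a\<close>,
      so \<open>f - f a *\<^sub>R f0\<close> vanishes on \<open>insert a F\<close> whenever
      \<open>f\<close> vanishes on \<open>F\<close>.\<close>
    define f0 where "f0 = (1 / f1 a) *\<^sub>R f1"
    have f0: "\<And>x. x \<in> F \<Longrightarrow> blinfun_apply f0 x = 0" "f0 a = 1"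
      using f1 by (auto simp: f0_def blinfun.scaleR_left)
    have "(\<phi> - \<phi> f0 *\<^sub>R canonical_embedding a) f = 0" if f: "\<forall>x\<in>F. blinfun_apply f x = 0" for f
    proof -
      have "\<phi> (f - f a *\<^sub>R f0) = 0"
        using f f0 by (intro insert.prems) (auto simp: blinfun.diff_left blinfun.scaleR_left)
      then show ?thesis
        by (simp add: blinfun.diff_left blinfun.scaleR_left blinfun.diff_right
            blinfun.scaleR_right canonical_embedding_apply)
    qed
    then obtain x where "canonical_embedding x = \<phi> - \<phi> f0 *\<^sub>R canonical_embedding a"
      using insert.IH by blast
    moreover have "canonical_embedding (x + \<phi> f0 *\<^sub>R a)
        = canonical_embedding x + \<phi> f0 *\<^sub>R canonical_embedding a"
      by (intro blinfun_eqI) (simp add: canonical_embedding_apply blinfun.add_left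
          blinfun.scaleR_left blinfun.add_right blinfun.scaleR_right)
    ultimately have "canonical_embedding (x + \<phi> f0 *\<^sub>R a) = \<phi>"
      by simp
    then show ?thesis by blast
  qed
qed

text \<open>A basic weak* neighbourhood of 0 constrains only finitely many points. Functionals
  vanishing there can be scaled freely inside it, so a bounded \<open>\<phi>\<close>-image forces
  \<open>\<phi>\<close> to vanish on them.\<close>

lemma weak_star_continuous_imp_canonical_embedding:
  fixes \<phi> :: "('a::real_normed_vector \<Rightarrow>\<^sub>L real) \<Rightarrow>\<^sub>L real"
  assumes "continuous_map weak_star_topology euclidean (blinfun_apply \<phi>)"
  shows "\<exists>x. canonical_embedding x = \<phi>"
proof -
  have "openin weak_star_topology {f \<in> topspace weak_star_topology. \<phi> f \<in> ball 0 1}"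
    using assms by (rule openin_continuous_map_preimage) simp
  then obtain U where U: "open U" "{f. \<phi> f \<in> ball 0 1} = blinfun_apply -` U"
    by (auto simp: weak_star_topology_def strong_operator_topology_def openin_pullback_topology
        topspace_pullback_topology)
  have "0 \<in> {f. \<phi> f \<in> ball 0 1}"
    by simp
  then have "(\<lambda>x. 0) \<in> U"
    unfolding U(2) by (simp add: zero_blinfun.rep_eq)
  with U(1) obtain X where X: "(\<lambda>x. 0) \<in> (\<Pi>\<^sub>E i\<in>UNIV. X i)" "finite {i. X i \<noteq> UNIV}"
    "(\<Pi>\<^sub>E i\<in>UNIV. X i) \<subseteq> U"
    using product_topology_open_contains_basis[of "\<lambda>_. euclidean" UNIV U "\<lambda>x. 0"]
    by (auto simp: open_fun_def)
  have "\<phi> f = 0" if f: "\<forall>x\<in>{i. X i \<noteq> UNIV}. blinfun_apply f x = 0" for f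
  proof (rule ccontr)
    assume nz: "\<phi> f \<noteq> 0"
    \<comment> \<open>The scaling gives \<open>\<phi>\<close> the value 1, just outside the open
      unit ball.\<close>
    have "blinfun_apply ((1 / \<phi> f) *\<^sub>R f) x \<in> X x" for x
    proof (cases "X x = UNIV")
      case False
      then have "blinfun_apply ((1 / \<phi> f) *\<^sub>R f) x = 0"
        using f by (simp add: blinfun.scaleR_left)
      then show ?thesis using X(1) by (auto simp: PiE_iff)
    qed simp
    then have "(1 / \<phi> f) *\<^sub>R f \<in> blinfun_apply -` U"
      using X(3) by (auto simp: PiE_iff)
    then have "\<phi> ((1 / \<phi> f) *\<^sub>R f) \<in> ball 0 1"
      using U(2) by blast
    then show False
      using nz by (simp add: blinfun.scaleR_right)
  qed
  then show ?thesis
    using X(2) by (rule canonical_embedding_if_vanishes_on_annihilator[rotated])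
qed

text \<open>\<open>g\<close> is weakly continuous, so its composition with \<open>T\<close> is weak*
  continuous and hence an evaluation at a unique point of the predual.\<close>

lemma canonical_embedding_predual_adjoint:
  assumes "T \<in> weak_star_weak_compact_operators"
  shows "canonical_embedding (predual_adjoint T g) = dual_adjoint T g"
proof -
  have "continuous_map weak_topology euclidean (blinfun_apply g)"
  proof -
    have "continuous_map weak_topology euclidean ((\<lambda>h. h g) \<circ> (\<lambda>x f. blinfun_apply f x))"
      unfolding weak_topology_def
      by (intro continuous_map_pullback) (simp add: continuous_on_product_coordinates)
    then show ?thesis by (simp add: o_def)
  qed
  then have "continuous_map weak_star_topology euclidean (blinfun_apply g \<circ> blinfun_apply T)"
    using assms by (intro continuous_map_compose) (auto simp: weak_star_weak_compact_operators_def)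
  then have "continuous_map weak_star_topology euclidean (blinfun_apply (dual_adjoint T g))"
    by (simp add: dual_adjoint_def o_def blinfun_compose.rep_eq)
  then have "\<exists>!x. canonical_embedding x = dual_adjoint T g"
    using weak_star_continuous_imp_canonical_embedding canonical_embedding_inject by metis
  then show ?thesis
    unfolding predual_adjoint_def by (rule theI')
qed

theorem theorem1:
  fixes p :: real
  assumes "1 \<le> p"
  shows
    "(gelfand_phillips (UNIV :: 'y::banach set) \<longrightarrow>
       (\<forall>M :: (('x::banach \<Rightarrow>\<^sub>L real) \<Rightarrow>\<^sub>L 'y) set.
          subspace M \<and> closedin (top_of_set weak_star_weak_compact_operators) M \<and>
          (\<forall>g :: 'y \<Rightarrow>\<^sub>L real. limited_p_convergent_on p M (\<lambda>T. predual_adjoint T g)) \<longrightarrow>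
          p_gelfand_phillips p M)) \<and>
     (gelfand_phillips (UNIV :: 'y set) \<longrightarrow>
       (\<forall>M :: ('x \<Rightarrow>\<^sub>L 'y) set.
          subspace M \<and> closedin (top_of_set compact_operators) M \<and>
          (\<forall>g :: 'y \<Rightarrow>\<^sub>L real. limited_p_convergent_on p M (\<lambda>T. dual_adjoint T g)) \<longrightarrow>
          p_gelfand_phillips p M))"
proof (intro conjI impI allI; elim conjE)
  fix M :: "(('x \<Rightarrow>\<^sub>L real) \<Rightarrow>\<^sub>L 'y) set"
  assume GP: "gelfand_phillips (UNIV :: 'y set)"
    and "closedin (top_of_set weak_star_weak_compact_operators) M"
    and ev: "\<forall>g :: 'y \<Rightarrow>\<^sub>L real. limited_p_convergent_on p M (\<lambda>T. predual_adjoint T g)"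
  then have M: "M \<subseteq> weak_star_weak_compact_operators"
    using closedin_imp_subset by blast
  show "p_gelfand_phillips p M"
  proof (rule p_gelfand_phillips_if_adjoints_null[OF GP])
    show "M \<subseteq> compact_operators"
      using M by (auto simp: weak_star_weak_compact_operators_def)
    fix T :: "nat \<Rightarrow> ('x \<Rightarrow>\<^sub>L real) \<Rightarrow>\<^sub>L 'y" and g :: "'y \<Rightarrow>\<^sub>L real"
    assume T: "limited_on M (range T)" "weakly_summable_on p M T"
    then have "(\<lambda>n. predual_adjoint (T n) g) \<longlonglongrightarrow> 0"
      using ev by (auto simp: limited_p_convergent_on_def)
    \<comment> \<open>The hypothesis gives convergence in the predual; the canonical embedding
      carries it to the bidual without increasing norms.\<close>
    moreover have "norm (dual_adjoint (T n) g) \<le> norm (predual_adjoint (T n) g)" for n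
    proof -
      have "T n \<in> weak_star_weak_compact_operators"
        using T(1) M by (auto simp: limited_on_def)
      then show ?thesis
        using norm_canonical_embedding_le[of "predual_adjoint (T n) g"]
        by (simp add: canonical_embedding_predual_adjoint)
    qed
    ultimately show "(\<lambda>n. dual_adjoint (T n) g) \<longlonglongrightarrow> 0"
      by - (rule tendsto_0_le[where K = 1], assumption, simp)
  qed
next
  fix M :: "('x \<Rightarrow>\<^sub>L 'y) set"
  assume GP: "gelfand_phillips (UNIV :: 'y set)"
    and "closedin (top_of_set compact_operators) M"
    and ev: "\<forall>g :: 'y \<Rightarrow>\<^sub>L real. limited_p_convergent_on p M (\<lambda>T. dual_adjoint T g)"
  then have "M \<subseteq> compact_operators"
    using closedin_imp_subset by blast
  \<comment> \<open>Here the evaluation operators are the adjoints themselves, so their convergence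
    is immediate.\<close>
  with GP show "p_gelfand_phillips p M"
    using ev by (intro p_gelfand_phillips_if_adjoints_null) (auto simp: limited_p_convergent_on_def)
qed

end
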